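(* Let $M \in \mathbb{R}^{3\times 3}$ with $\det(M) > 0$ and singular value decomposition $M = U\Sigma V^\top$ with distinct singular values $s_1 > s_2 > s_3 > 0$. Let $J_{\mathrm{SVD}} = \frac{\partial\,\mathrm{vec}(R)}{\partial\,\mathrm{vec}(M)} \in \mathbb{R}^{9\times 9}$ be the Jacobian at $M$ of the mapping $M \mapsto R = UV^\top$. Then $J_{\mathrm{SVD}}$ has rank $3$ (which is the dimension of $\mathrm{SO}(3)$) and a $6$-dimensional null space, and its singular values, with multiplicity, are $$\frac{2}{s_1+s_2},\quad \frac{2}{s_1+s_3},\quad \frac{2}{s_2+s_3},\quad 0,\,0,\,0,\,0,\,0,\,0.$$ Consequently its spectral norm and its condition number are $$\lVert J_{\mathrm{SVD}}\rVert_2 = \frac{2}{s_2+s_3}, \qquad \kappa(J_{\mathrm{SVD}}) = \frac{s_1+s_2}{s_2+s_3}.$$ Moreover, $\lVert J_{\mathrm{SVD}}\rVert_2 = O(1/s_3)$ as $s_3 \to 0$.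
   Context: For a $3\times 3$ matrix $M$, $M = U\Sigma V^\top$ denotes its singular value decomposition with $U,V$ orthogonal $3 \times 3$ matrices and $\Sigma = \mathrm{diag}(s_1,s_2,s_3)$, $s_1\ge s_2\ge s_3\ge 0$. When $\det(M)>0$, the matrix $R = UV^\top$ lies in $\mathrm{SO}(3)$ and depends only on $M$ (it is the orthogonal polar factor of $M$). $\mathrm{vec}$ stacks the entries of a matrix into a vector in $\mathbb{R}^9$, so that the Euclidean norm corresponds to the Frobenius norm. The condition number $\kappa$ of a rank-deficient Jacobian means the ratio of its largest to its smallest nonzero singular value. *)

theory Defs
  imports
    "HOL-Analysis.Analysis"
    "HOL-Library.Multiset"
    "HOL-Library.Landau_Symbols"
    "HOL-Computational_Algebra.Polynomial"
begin

section \<open>Singular value decomposition\<close>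

definition diag :: "real^'n \<Rightarrow> real^'n^'n"
  where "diag s = (\<chi> i j. if i = j then s $ i else 0)"

text \<open>No order is imposed on the diagonal entries: the index type need not be ordered, and
  neither the multiset of singular values nor \<open>U ** transpose V\<close> (for invertible \<open>M\<close>) depends
  on it; see \<open>singular_values_eqI\<close> and \<open>polar_rotation_eqI\<close> below.\<close>

definition is_svd :: "real^'n^'n \<Rightarrow> real^'n^'n \<Rightarrow> real^'n \<Rightarrow> real^'n^'n \<Rightarrow> bool"
  where "is_svd M U s V \<longleftrightarrow>
    orthogonal_matrix U \<and> orthogonal_matrix V \<and> (\<forall>i. 0 \<le> s $ i) \<and>
    M = U ** diag s ** transpose V"

definition singular_values :: "real^'n^'n \<Rightarrow> real multiset"
  where "singular_values A =
    (THE S. \<exists>U s V. is_svd A U s V \<and> S = image_mset (($) s) (mset_set UNIV))"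

text \<open>For a rank-deficient matrix the smallest \<^emph>\<open>nonzero\<close> singular value is used.\<close>

definition condition_number :: "real^'n^'n \<Rightarrow> real"
  where "condition_number A =
    Max (set_mset (singular_values A)) / Min (set_mset (singular_values A) - {0})"

definition spectral_norm :: "real^'n^'n \<Rightarrow> real"
  where "spectral_norm A = onorm ((*v) A)"


section \<open>The rotation factor and its Jacobian\<close>

definition polar_rotation :: "real^3^3 \<Rightarrow> real^3^3"
  where "polar_rotation M = (THE R. \<exists>U s V. is_svd M U s V \<and> R = U ** transpose V)"

text \<open>Vectors in nine-dimensional space are indexed by the pairs \<open>(i, j)\<close> of a row and a column
  index. The Euclidean norm of \<open>vec_of_mat A\<close> is the Frobenius norm of \<open>A\<close>.\<close>

definition vec_of_mat :: "real^3^3 \<Rightarrow> real^(3 \<times> 3)"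
  where "vec_of_mat A = (\<chi> p. A $ fst p $ snd p)"

definition mat_of_vec :: "real^(3 \<times> 3) \<Rightarrow> real^3^3"
  where "mat_of_vec x = (\<chi> i j. x $ (i, j))"

definition vec_polar_rotation :: "real^(3 \<times> 3) \<Rightarrow> real^(3 \<times> 3)"
  where "vec_polar_rotation x = vec_of_mat (polar_rotation (mat_of_vec x))"

definition J_SVD :: "real^3^3 \<Rightarrow> real^(3 \<times> 3)^(3 \<times> 3)"
  where "J_SVD M = jacobian vec_polar_rotation (at (vec_of_mat M))"


section \<open>The dimension of the rotation group\<close>

definition SO3 :: "(real^3^3) set"
  where "SO3 = {R. orthogonal_matrix R \<and> det R = 1}"

text \<open>Velocities at \<open>p\<close> of curves in \<open>S\<close>. For a smooth submanifold \<open>S\<close> this is the tangent space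
  at \<open>p\<close>, whose dimension is the dimension of \<open>S\<close>.\<close>

definition tangent_space :: "'a::real_normed_vector set \<Rightarrow> 'a \<Rightarrow> 'a set"
  where "tangent_space S p =
    {v. \<exists>\<gamma>. (\<forall>t::real. \<gamma> t \<in> S) \<and> \<gamma> 0 = p \<and> (\<gamma> has_vector_derivative v) (at 0)}"


section \<open>Independence of the chosen decomposition\<close>

lemma mat_of_vec_of_mat [simp]: "mat_of_vec (vec_of_mat A) = A"
  by (simp add: mat_of_vec_def vec_of_mat_def vec_eq_iff)

lemma vec_of_mat_of_vec [simp]: "vec_of_mat (mat_of_vec x) = x"
  by (simp add: mat_of_vec_def vec_of_mat_def vec_eq_iff)

lemma transpose_diag [simp]: "transpose (diag s) = diag s"
  by (auto simp: diag_def transpose_def vec_eq_iff)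

lemma diag_mult_nth: "(diag s ** X) $ i $ j = s $ i * X $ i $ j"
proof -
  have "(diag s ** X) $ i $ j = (\<Sum>k\<in>UNIV. if i = k then s $ i * X $ k $ j else 0)"
    unfolding diag_def matrix_matrix_mult_def vec_lambda_beta by (rule sum.cong) auto
  then show ?thesis
    by (simp only: sum.delta sum.delta' finite UNIV_I if_True)
qed

lemma mult_diag_nth: "(X ** diag s) $ i $ j = X $ i $ j * s $ j"
proof -
  have "(X ** diag s) $ i $ j = (\<Sum>k\<in>UNIV. if k = j then X $ i $ k * s $ j else 0)"
    unfolding diag_def matrix_matrix_mult_def vec_lambda_beta by (rule sum.cong) auto
  then show ?thesis
    by (simp only: sum.delta sum.delta' finite UNIV_I if_True)
qed

lemma diag_mult_diag: "diag s ** diag t = diag (\<chi> i. s $ i * t $ i)"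
  by (simp add: vec_eq_iff diag_mult_nth) (simp add: diag_def)

lemma det_diag: "det (diag s) = (\<Prod>i\<in>UNIV. s $ i)"
  by (subst det_diagonal) (auto simp: diag_def)

lemma matrix_diff_conj: "A ** (B - C) ** D = A ** B ** D - A ** C ** (D :: real^'n^'n)"
  by (simp add: matrix_matrix_mult_def vec_eq_iff sum_subtractf algebra_simps)

lemma gram_svd:
  assumes "is_svd A U s V"
  shows "transpose A ** A = V ** diag (\<chi> i. (s $ i)\<^sup>2) ** transpose V"
proof -
  have A: "A = U ** diag s ** transpose V" and U: "transpose U ** U = mat 1"
    using assms by (auto simp: is_svd_def orthogonal_matrix_def)
  have "transpose A ** A = V ** (diag s ** (transpose U ** U) ** diag s) ** transpose V"
    by (simp add: A matrix_transpose_mul matrix_mul_assoc)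
  then show ?thesis
    by (simp add: U diag_mult_diag power2_eq_square)
qed

lemma charpoly_gram_svd:
  assumes "is_svd A U s V"
  shows "det (mat x - transpose A ** A) = (\<Prod>i\<in>UNIV. x - (s $ i)\<^sup>2)"
proof -
  have V: "V ** transpose V = mat 1" "orthogonal_matrix V"
    using assms by (auto simp: is_svd_def orthogonal_matrix_def)
  have d: "det V * det V = 1"
    using det_orthogonal_matrix[OF V(2)] by auto
  have x: "mat x = x *\<^sub>R (mat 1 :: real^'a^'a)"
    by (simp add: mat_def vec_eq_iff)
  have e: "diag (\<chi> i. x - (s $ i)\<^sup>2) = mat x - diag (\<chi> i. (s $ i)\<^sup>2)"
    by (simp add: diag_def mat_def vec_eq_iff)
  have "V ** mat x ** transpose V = mat x"
    by (simp add: x V(1) matrix_scalar_ac flip: scalar_matrix_assoc)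
  then have "mat x - transpose A ** A = V ** diag (\<chi> i. x - (s $ i)\<^sup>2) ** transpose V"
    unfolding gram_svd[OF assms] e
    by (simp add: matrix_diff_conj)
  then show ?thesis
    using d by (simp add: det_mul det_diag)
qed

lemma svd_mset_unique:
  fixes A :: "real^'n^'n"
  assumes "is_svd A U s V" "is_svd A U' s' V'"
  shows "image_mset (($) s) (mset_set UNIV) = image_mset (($) s') (mset_set UNIV)"
proof -
  define p where "p = (\<lambda>s :: real^'n. \<Prod>i\<in>UNIV. [:- ((s $ i)\<^sup>2), 1:])"
  have "poly (p s) x = poly (p s') x" for x
    using charpoly_gram_svd[OF assms(1), of x] charpoly_gram_svd[OF assms(2), of x]
    by (simp add: p_def poly_prod)
  then have eq: "p s = p s'"
    by (simp add: fun_eq_iff flip: poly_eq_poly_eq_iff)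
  have roots: "proots (p t) = image_mset (\<lambda>i. (t $ i)\<^sup>2) (mset_set UNIV)" for t
  proof -
    have "proots (p t) = (\<Sum>i\<in>UNIV. {#(t $ i)\<^sup>2#})"
      unfolding p_def by (subst proots_prod) auto
    then show ?thesis
      by (simp add: sum_unfold_sum_mset image_mset.compositionality)
  qed
  have recover: "image_mset (($) t) (mset_set UNIV) = image_mset sqrt (proots (p t))"
    if "\<forall>i. 0 \<le> t $ i" for t
    using that by (simp add: roots image_mset.compositionality comp_def)
  show ?thesis
    using assms recover[of s] recover[of s'] eq by (simp add: is_svd_def)
qed

lemma singular_values_eqI:
  assumes "is_svd A U s V"
  shows "singular_values A = image_mset (($) s) (mset_set UNIV)"
  unfolding singular_values_def
proof (rule the_equality)
  show "\<exists>U' s' V'. is_svd A U' s' V' \<and>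
      image_mset (($) s) (mset_set UNIV) = image_mset (($) s') (mset_set UNIV)"
    using assms by blast
next
  fix S
  assume "\<exists>U' s' V'. is_svd A U' s' V' \<and> S = image_mset (($) s') (mset_set UNIV)"
  then show "S = image_mset (($) s) (mset_set UNIV)"
    using svd_mset_unique[OF assms] by auto
qed

lemma polar_factor_unique:
  fixes M :: "real^'n^'n"
  assumes "det M \<noteq> 0" and 1: "is_svd M U s V" and 2: "is_svd M U' s' V'"
  shows "U ** transpose V = U' ** transpose V'"
proof -
  define W where "W = transpose U ** U'"
  define Z where "Z = transpose V ** V'"
  have M: "M = U ** diag s ** transpose V" and M': "M = U' ** diag s' ** transpose V'"
    and inv: "transpose U ** U = mat 1" "U ** transpose U = mat 1"
      "transpose V ** V = mat 1" "V ** transpose V = mat 1"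
      "transpose U' ** U' = mat 1" "U' ** transpose U' = mat 1"
      "transpose V' ** V' = mat 1" "V' ** transpose V' = mat 1"
    and nonneg: "0 \<le> s $ i" "0 \<le> s' $ i" for i
    using 1 2 by (auto simp: is_svd_def orthogonal_matrix_def)
  have "det (diag s) \<noteq> 0"
    using assms(1) by (auto simp: M det_mul)
  then have pos: "0 < s $ i" for i
    using nonneg(1)[of i] by (auto simp: det_diag order_less_le)
  have "transpose U ** M ** V' = diag s ** Z"
    unfolding M Z_def by (simp add: matrix_mul_assoc inv)
  moreover have "transpose U ** M ** V' = W ** diag s' ** (transpose V' ** V')"
    unfolding M' W_def by (simp add: matrix_mul_assoc)
  ultimately have DZ: "diag s ** Z = W ** diag s'"
    by (simp add: inv)
  have "transpose V ** transpose M ** U' = (transpose V ** V) ** diag s ** W"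
    unfolding M W_def by (simp add: matrix_mul_assoc matrix_transpose_mul)
  moreover have "transpose V ** transpose M ** U' = Z ** diag s' ** (transpose U' ** U')"
    unfolding M' Z_def by (simp add: matrix_mul_assoc matrix_transpose_mul)
  ultimately have DW: "diag s ** W = Z ** diag s'"
    by (simp add: inv)
  have "(s $ i + s' $ j) * (Z $ i $ j - W $ i $ j) = 0" for i j
    using arg_cong[OF DZ, of "\<lambda>X. X $ i $ j"] arg_cong[OF DW, of "\<lambda>X. X $ i $ j"]
    by (simp add: diag_mult_nth mult_diag_nth algebra_simps)
  moreover have "s $ i + s' $ j \<noteq> 0" for i j
    using pos[of i] nonneg(2)[of j] by linarith
  ultimately have "Z = W"
    by (simp add: vec_eq_iff)
  then have "U ** Z ** transpose V' = U ** W ** transpose V'"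
    by simp
  moreover have "U ** Z ** transpose V' = U ** transpose V ** (V' ** transpose V')"
    by (simp add: Z_def matrix_mul_assoc)
  moreover have "U ** W ** transpose V' = (U ** transpose U) ** U' ** transpose V'"
    by (simp add: W_def matrix_mul_assoc)
  ultimately show ?thesis
    by (simp add: inv)
qed

lemma polar_rotation_eqI:
  assumes "det M \<noteq> 0" "is_svd M U s V"
  shows "polar_rotation M = U ** transpose V"
  unfolding polar_rotation_def
proof (rule the_equality)
  show "\<exists>U' s' V'. is_svd M U' s' V' \<and> U ** transpose V = U' ** transpose V'"
    using assms(2) by blast
next
  fix R
  assume "\<exists>U' s' V'. is_svd M U' s' V' \<and> R = U' ** transpose V'"
  then show "R = U ** transpose V"
    using polar_factor_unique[OF assms] by auto
qed

end

theory Submission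
  imports Defs
begin

text \<open>After conjugating with \<open>U\<close> and \<open>V\<close> we may perturb a positive diagonal matrix \<open>S\<close>. If
  \<open>W = I + D\<close> is the orthogonal polar factor of \<open>S + E\<close>, symmetry of \<open>W\<^sup>T (S + E)\<close> together with
  orthogonality of \<open>W\<close> gives \<open>S D + D S = E - E\<^sup>T\<close> up to terms quadratic in \<open>D\<close> and \<open>E\<close>, and
  \<open>D = O(E)\<close> because \<open>W\<close> maximises the trace pairing with \<open>S + E\<close>. Hence the derivative is
  \<open>E\<^sub>i\<^sub>j \<mapsto> (E\<^sub>i\<^sub>j - E\<^sub>j\<^sub>i) / (s\<^sub>i + s\<^sub>j)\<close>. It is diagonal in the orthonormal basis of normalised
  elementary skew and symmetric matrices, with eigenvalues \<open>2 / (s\<^sub>i + s\<^sub>j)\<close> for \<open>i < j\<close> on the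
  skew part and \<open>0\<close> on the symmetric part.\<close>

section \<open>Existence of the singular value decomposition\<close>

text \<open>The Rayleigh quotient attains its maximum on the compact unit sphere of
  \<open>W\<close>. At a maximiser \<open>v\<close> the residual \<open>f v - c *\<^sub>R v\<close>
  lies in \<open>W\<close> and is orthogonal to \<open>v\<close>, and maximality forces it to
  vanish.\<close>

lemma selfadjoint_eigenvector:
  fixes f :: "'a::euclidean_space \<Rightarrow> 'a"
  assumes f: "linear f" and sa: "\<And>x y. x \<bullet> f y = f x \<bullet> y"
    and W: "subspace W" and inv: "\<And>x. x \<in> W \<Longrightarrow> f x \<in> W" and ne: "W \<noteq> {0}"
  obtains v c where "v \<in> W" "norm v = 1" "f v = c *\<^sub>R v"
proof -
  interpret f: linear f by (rule f)
  have ne': "sphere 0 1 \<inter> W \<noteq> {}"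
  proof -
    obtain w where "w \<in> W" "w \<noteq> 0"
      using ne subspace_0[OF W] by auto
    then have "w /\<^sub>R norm w \<in> sphere 0 1 \<inter> W"
      by (auto intro: subspace_scale[OF W])
    then show ?thesis by blast
  qed
  have "compact (sphere 0 1 \<inter> W)"
    by (intro compact_Int_closed compact_sphere closed_subspace W)
  moreover have "continuous_on (sphere 0 1 \<inter> W) (\<lambda>x. x \<bullet> f x)"
    by (intro continuous_intros linear_continuous_on linear_linear[THEN iffD2] f)
  ultimately obtain v where v: "v \<in> W" "norm v = 1"
    and max: "\<And>x. x \<in> W \<Longrightarrow> norm x = 1 \<Longrightarrow> x \<bullet> f x \<le> v \<bullet> f v"
    using continuous_attains_sup[OF _ ne', of "\<lambda>x. x \<bullet> f x"] by (auto simp: dist_norm)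
  define c where "c = v \<bullet> f v"
  have max': "x \<bullet> f x \<le> c * (norm x)\<^sup>2" if "x \<in> W" for x
  proof (cases "x = 0")
    case False
    then have "(x /\<^sub>R norm x) \<bullet> f (x /\<^sub>R norm x) \<le> c"
      unfolding c_def using that by (intro max subspace_scale[OF W]) auto
    then show ?thesis
      using False by (simp add: f.scaleR field_simps power2_eq_square)
  qed (simp add: f.zero)
  define u where "u = f v - c *\<^sub>R v"
  have u: "u \<in> W"
    unfolding u_def by (intro subspace_diff[OF W] subspace_scale[OF W] inv v)
  have vv: "v \<bullet> v = 1"
    using v by (simp add: norm_eq_1)
  have uv: "v \<bullet> u = 0"
    by (simp add: u_def inner_diff_right vv c_def)
  have ufv: "u \<bullet> f v = u \<bullet> u"
    using uv by (simp add: u_def inner_diff_right inner_commute)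
  \<comment> \<open>First-order condition at the maximiser \<open>v\<close> in the direction \<open>u\<close>.\<close>
  have quad: "2 * t * (u \<bullet> u) \<le> t\<^sup>2 * (c * (u \<bullet> u) - u \<bullet> f u)" for t :: real
  proof -
    have "(v + t *\<^sub>R u) \<bullet> f (v + t *\<^sub>R u) \<le> c * (norm (v + t *\<^sub>R u))\<^sup>2"
      by (intro max' subspace_add[OF W] subspace_scale[OF W] u v)
    moreover have "(v + t *\<^sub>R u) \<bullet> f (v + t *\<^sub>R u) = c + 2 * t * (u \<bullet> u) + t\<^sup>2 * (u \<bullet> f u)"
      using ufv sa[of v u] inner_commute[of "f v" u]
      by (simp add: f.add f.scaleR inner_add_left inner_add_right c_def power2_eq_square
          algebra_simps)
    moreover have "(norm (v + t *\<^sub>R u))\<^sup>2 = 1 + t\<^sup>2 * (u \<bullet> u)"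
      using uv vv unfolding power2_norm_eq_inner
      by (simp add: inner_add_left inner_add_right inner_commute power2_eq_square)
    ultimately show ?thesis
      by (simp add: algebra_simps)
  qed
  have "u \<bullet> u = 0"
  proof (rule ccontr)
    assume "u \<bullet> u \<noteq> 0"
    then have p: "u \<bullet> u > 0" by (simp add: order_less_le)
    \<comment> \<open>\<open>K\<close> is a positive bound for the quadratic coefficient. The step
      \<open>t = (u \<bullet> u) / K\<close> is then so short that the linear gain outweighs the
      quadratic loss.\<close>
    define K where "K = \<bar>c * (u \<bullet> u) - u \<bullet> f u\<bar> + 1"
    have K: "K > 0" "c * (u \<bullet> u) - u \<bullet> f u \<le> K"
      by (auto simp: K_def)
    let ?t = "(u \<bullet> u) / K"
    have "2 * ?t * (u \<bullet> u) \<le> ?t\<^sup>2 * K"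
      using quad[of ?t] K(2) mult_left_mono[OF K(2), of "?t\<^sup>2"] by simp
    then have "2 * ((u \<bullet> u)\<^sup>2 / K) \<le> (u \<bullet> u)\<^sup>2 / K"
      using K(1) by (simp add: power2_eq_square)
    moreover have "(u \<bullet> u)\<^sup>2 / K > 0"
      using p K(1) by simp
    ultimately show False by linarith
  qed
  then have "f v = c *\<^sub>R v"
    by (simp add: u_def)
  then show ?thesis
    using v that by blast
qed

text \<open>Split off one unit eigenvector \<open>v\<close> and recurse: by self-adjointness the
  orthogonal complement of \<open>v\<close> in \<open>W\<close> is again invariant, and its
  dimension is one less.\<close>

lemma selfadjoint_orthonormal_eigenbasis:
  fixes f :: "'a::euclidean_space \<Rightarrow> 'a"
  assumes f: "linear f" and sa: "\<And>x y. x \<bullet> f y = f x \<bullet> y"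
  shows "subspace W \<Longrightarrow> (\<And>x. x \<in> W \<Longrightarrow> f x \<in> W) \<Longrightarrow>
    \<exists>B. B \<subseteq> W \<and> card B = dim W \<and> finite B \<and> pairwise orthogonal B \<and>
      (\<forall>b\<in>B. norm b = 1 \<and> (\<exists>c. f b = c *\<^sub>R b))"
proof (induction "dim W" arbitrary: W)
  case 0
  then have "W \<subseteq> {0}" by (simp add: dim_eq_0)
  then have "dim W = 0" by simp
  then show ?case by (intro exI[of _ "{}"]) auto
next
  case (Suc n)
  then have "W \<noteq> {0}" by auto
  with Suc.prems obtain v c where v: "v \<in> W" "norm v = 1" "f v = c *\<^sub>R v"
    using selfadjoint_eigenvector[OF f sa] by metis
  define W' where "W' = {w \<in> W. v \<bullet> w = 0}"
  have W': "subspace W'"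
    using Suc.prems(1) unfolding W'_def
    by (auto simp: subspace_def inner_add_right)
  have inv': "f x \<in> W'" if "x \<in> W'" for x
    using that Suc.prems(2)[of x] sa[of v x] by (simp add: W'_def v)
  have "dim W' = n"
  proof -
    have "dim {y \<in> W. \<forall>x\<in>span {v}. orthogonal x y} + dim (span {v}) = dim W"
      using v(1) Suc.prems(1)
      by (intro dim_subspace_orthogonal_to_vectors subspace_span span_minimal) auto
    moreover have "{y \<in> W. \<forall>x\<in>span {v}. orthogonal x y} = W'"
      by (auto simp: W'_def orthogonal_def span_singleton)
    moreover have "dim {v} = 1"
      using v by (auto simp: dim_eq_card_independent dependent_single)
    ultimately show ?thesis
      using Suc.hyps(2) by (simp add: dim_span)
  qed
  with Suc.hyps(1)[of W'] W' inv' obtain B where B: "B \<subseteq> W'" "card B = n" "finite B"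
    "pairwise orthogonal B" "\<And>b. b \<in> B \<Longrightarrow> norm b = 1" "\<And>b. b \<in> B \<Longrightarrow> \<exists>c. f b = c *\<^sub>R b"
    by metis
  have "v \<notin> B"
    using B(1) v(2) by (auto simp: W'_def)
  moreover have "pairwise orthogonal (insert v B)"
    using B(1,4) by (auto simp: pairwise_insert W'_def orthogonal_def inner_commute)
  moreover have "insert v B \<subseteq> W"
    using B(1) v(1) by (auto simp: W'_def)
  ultimately show ?case
    using B v Suc.hyps(2) by (intro exI[of _ "insert v B"]) auto
qed

text \<open>The hypothesis on \<open>A\<close> says columnwise that
  \<open>A ** V = U ** diag s\<close>; multiplying by \<open>transpose V\<close> on the right gives
  the decomposition. It serves for the matrix \<open>M\<close> and, with \<open>u = v\<close>, for
  its Jacobian.\<close>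

lemma columns_eq_imp_svd:
  fixes A :: "real^'n^'n" and u v :: "'n \<Rightarrow> real^'n"
  assumes u: "\<And>i j. u i \<bullet> u j = (if i = j then 1 else 0)"
    and v: "\<And>i j. v i \<bullet> v j = (if i = j then 1 else 0)"
    and A: "\<And>i. A *v v i = s $ i *\<^sub>R u i" and s: "\<And>i. 0 \<le> s $ i"
  shows "is_svd A (\<chi> i j. u j $ i) s (\<chi> i j. v j $ i)"
proof -
  let ?U = "\<chi> i j. u j $ i" and ?V = "\<chi> i j. v j $ i"
  have U: "orthogonal_matrix ?U" and V: "orthogonal_matrix ?V"
    using u v by (auto simp: orthogonal_matrix vec_eq_iff matrix_matrix_mult_def transpose_def
        mat_def inner_vec_def)
  have "A ** ?V = ?U ** diag s"
    using A by (simp add: vec_eq_iff mult_diag_nth)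
      (simp add: matrix_matrix_mult_def matrix_vector_mult_def mult.commute)
  then have "A ** (?V ** transpose ?V) = ?U ** diag s ** transpose ?V"
    by (simp add: matrix_mul_assoc)
  then show ?thesis
    using U V s by (simp add: is_svd_def orthogonal_matrix_def)
qed

text \<open>An orthonormal eigenbasis \<open>v\<close> of the Gram matrix
  \<open>transpose A ** A\<close> is mapped by \<open>A\<close> to orthogonal vectors whose squared
  lengths are the eigenvalues \<open>c\<close>. Invertibility makes these positive, so the images
  can be normalised to the columns of the left factor.\<close>

lemma invertible_svd_exists:
  fixes A :: "real^'n^'n"
  assumes "det A \<noteq> 0"
  obtains U s V where "is_svd A U s V"
proof -
  let ?f = "\<lambda>x. transpose A *v (A *v x)"
  have f: "linear ?f"
    using linear_compose[OF matrix_vector_mul_linear[of A] matrix_vector_mul_linear[of "transpose A"]]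
    by (simp add: o_def)
  have gram: "x \<bullet> ?f y = (A *v x) \<bullet> (A *v y)" for x y
    using dot_lmul_matrix[of "A *v y" A x] by (simp add: inner_commute)
  have sa: "x \<bullet> ?f y = ?f x \<bullet> y" for x y
    using gram[of x y] gram[of y x] by (simp add: inner_commute)
  obtain B where B: "card B = CARD('n)" "finite B" "pairwise orthogonal B"
    "\<And>b. b \<in> B \<Longrightarrow> norm b = 1" "\<And>b. b \<in> B \<Longrightarrow> \<exists>c. ?f b = c *\<^sub>R b"
    using selfadjoint_orthonormal_eigenbasis[OF f sa, of UNIV] by auto
  obtain v where "bij_betw v (UNIV :: 'n set) B"
    using finite_same_card_bij[of "UNIV :: 'n set" B] B by auto
  then have vB: "v i \<in> B" and inj: "v i = v j \<longleftrightarrow> i = j" for i j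
    by (auto simp: bij_betw_def inj_on_def)
  have v: "v i \<bullet> v j = (if i = j then 1 else 0)" for i j
    using B(3,4) vB inj by (auto simp: pairwise_def orthogonal_def norm_eq_1)
  obtain c where c: "\<And>i. ?f (v i) = c i *\<^sub>R v i"
    using choice[OF allI, of "\<lambda>i c. ?f (v i) = c *\<^sub>R v i"] B(5)[OF vB] by blast
  have Av: "(A *v v i) \<bullet> (A *v v j) = (if i = j then c j else 0)" for i j
    using gram[of "v i" "v j", unfolded c] by (cases "i = j") (simp_all add: v)
  have pos: "c i > 0" for i
  proof -
    have "v i \<noteq> 0"
      using v[of i i] by auto
    then have "A *v v i \<noteq> 0"
      using assms by (metis invertible_det_nz invertible_def matrix_left_invertible_ker)
    then show ?thesis
      using Av[of i i] by (metis inner_gt_zero_iff)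
  qed
  have "is_svd A (\<chi> i j. ((A *v v j) /\<^sub>R sqrt (c j)) $ i) (\<chi> i. sqrt (c i)) (\<chi> i j. v j $ i)"
  proof (rule columns_eq_imp_svd)
    have "sqrt (c i) * sqrt (c i) = c i" and nz: "sqrt (c i) \<noteq> 0" for i
      using pos[of i] by auto
    then have "inverse (sqrt (c i)) * (inverse (sqrt (c i)) * c i) = 1" for i
      by (metis mult.assoc left_inverse mult.right_neutral)
    then show "((A *v v i) /\<^sub>R sqrt (c i)) \<bullet> ((A *v v j) /\<^sub>R sqrt (c j)) = (if i = j then 1 else 0)"
      for i j
      by (simp add: Av)
    show "A *v v i = (\<chi> i. sqrt (c i)) $ i *\<^sub>R ((A *v v i) /\<^sub>R sqrt (c i))" for i
      using nz[of i] by simp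
  qed (use pos in \<open>auto simp: v less_imp_le\<close>)
  then show ?thesis ..
qed


section \<open>The derivative of the orthogonal polar factor\<close>

lemma inner_matrix_eq_trace: "(A :: real^'n^'m) \<bullet> B = trace (transpose A ** B)"
  unfolding trace_def matrix_matrix_mult_def transpose_def inner_vec_def
  by (simp add: sum.swap[of _ "UNIV :: 'n set"])

text \<open>Written as a trace, the inner product is cyclic, which brings \<open>transpose V\<close>
  next to \<open>V\<close> and cancels both orthogonal factors.\<close>

lemma inner_orthogonal_matrix_mult:
  fixes U V :: "real^'n^'n"
  assumes "orthogonal_matrix U" "orthogonal_matrix V"
  shows "(U ** A ** transpose V) \<bullet> (U ** B ** transpose V) = A \<bullet> B"
proof -
  have UV: "transpose U ** U = mat 1" "transpose V ** V = mat 1"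
    using assms by (auto simp: orthogonal_matrix_def)
  have "(U ** A ** transpose V) \<bullet> (U ** B ** transpose V) =
      trace ((V ** transpose A) ** (transpose U ** U) ** B ** transpose V)"
    by (simp add: inner_matrix_eq_trace matrix_transpose_mul matrix_mul_assoc)
  also have "\<dots> = trace (transpose V ** (V ** transpose A ** B))"
    by (subst trace_mul_sym) (simp add: UV)
  also have "\<dots> = trace ((transpose V ** V) ** transpose A ** B)"
    by (simp add: matrix_mul_assoc)
  finally show ?thesis
    by (simp add: UV inner_matrix_eq_trace)
qed

lemma norm_orthogonal_matrix_mult:
  fixes U V :: "real^'n^'n"
  assumes "orthogonal_matrix U" "orthogonal_matrix V"
  shows "norm (U ** A ** transpose V) = norm A"
  by (simp add: norm_eq_sqrt_inner inner_orthogonal_matrix_mult[OF assms])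

lemma matrix_add_rdistrib: "(A + B) ** C = A ** C + B ** (C :: 'a::semiring_1^'p^'n)"
  by (simp add: matrix_matrix_mult_def vec_eq_iff sum.distrib distrib_right)

lemma bounded_bilinear_matrix_mult:
  "bounded_bilinear ((**) :: real^'n^'m \<Rightarrow> real^'p^'n \<Rightarrow> real^'p^'m)"
  unfolding bilinear_conv_bounded_bilinear[symmetric] bilinear_def
  by (auto intro!: linearI simp: matrix_add_ldistrib matrix_add_rdistrib
      matrix_scalar_ac scalar_matrix_assoc)

lemma bounded_linear_transpose: "bounded_linear (transpose :: real^'n^'m \<Rightarrow> real^'m^'n)"
  unfolding linear_conv_bounded_linear[symmetric]
  by (auto intro!: linearI simp: transpose_def vec_eq_iff)

lemma norm_transpose: "norm (transpose (A :: real^'n^'m)) = norm A"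
  unfolding norm_eq_sqrt_inner inner_vec_def transpose_def
  by (simp add: sum.swap[of _ "UNIV :: 'n set"])

text \<open>The norm is the Frobenius norm; Cauchy-Schwarz is applied to each entry, a row of
  \<open>A\<close> times a column of \<open>B\<close>, and the squares are summed.\<close>

lemma norm_matrix_mult_le:
  fixes A :: "real^'n^'m" and B :: "real^'p^'n"
  shows "norm (A ** B) \<le> norm A * norm B"
proof (rule power2_le_imp_le)
  have sq: "(norm C)\<^sup>2 = (\<Sum>i\<in>UNIV. (norm (C $ i))\<^sup>2)" for C :: "real^'k^'j"
    unfolding power2_norm_eq_inner by (simp add: inner_vec_def)
  have "(norm (A ** B))\<^sup>2 = (\<Sum>i\<in>UNIV. \<Sum>j\<in>UNIV. (A $ i \<bullet> transpose B $ j)\<^sup>2)"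
    unfolding power2_norm_eq_inner inner_vec_def
    by (simp add: matrix_matrix_mult_def transpose_def power2_eq_square)
  also have "\<dots> \<le> (\<Sum>i\<in>UNIV. \<Sum>j\<in>UNIV. (norm (A $ i))\<^sup>2 * (norm (transpose B $ j))\<^sup>2)"
    by (intro sum_mono) (metis Cauchy_Schwarz_ineq2 abs_le_square_iff abs_mult abs_norm_cancel
        power_mult_distrib)
  also have "\<dots> = (norm A)\<^sup>2 * (norm (transpose B))\<^sup>2"
    by (simp only: sq sum_product)
  finally show "(norm (A ** B))\<^sup>2 \<le> (norm A * norm B)\<^sup>2"
    by (simp add: norm_transpose power_mult_distrib)
qed simp

text \<open>\<open>W\<close> and the identity have the same squared Frobenius norm, the dimension,
  and their inner product is the trace of \<open>W\<close>.\<close>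

lemma norm_orthogonal_matrix_sub_id:
  fixes W :: "real^'n^'n"
  assumes "orthogonal_matrix W"
  shows "(norm (W - mat 1))\<^sup>2 = 2 * (\<Sum>i\<in>UNIV. 1 - W $ i $ i)"
proof -
  have "W \<bullet> W = real CARD('n)"
    using assms by (simp add: inner_matrix_eq_trace orthogonal_matrix_def trace_I)
  moreover have "mat 1 \<bullet> (mat 1 :: real^'n^'n) = real CARD('n)"
    unfolding inner_matrix_eq_trace by (simp add: transpose_mat trace_I)
  moreover have "mat 1 \<bullet> W = (\<Sum>i\<in>UNIV. W $ i $ i)"
    unfolding inner_matrix_eq_trace by (simp add: transpose_mat trace_def)
  ultimately show ?thesis
    unfolding power2_norm_eq_inner
    by (simp add: inner_diff_left inner_diff_right inner_commute sum_subtractf)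
qed

lemma orthogonal_matrix_nth_le_1:
  fixes W :: "real^'n^'n"
  assumes "orthogonal_matrix W"
  shows "W $ i $ j \<le> 1"
proof -
  have "norm (row i W) = 1"
    using assms by (simp add: orthogonal_matrix_orthonormal_rows)
  then show ?thesis
    using component_le_norm_cart[of "row i W" j] by (simp add: row_def)
qed

section \<open>Perturbation of a positive diagonal matrix\<close>

text \<open>The orthogonal polar factor of \<open>A\<close> maximises \<open>\<lambda>Z. Z \<bullet> A\<close> over orthogonal \<open>Z\<close>; comparing
  its value with that of the identity gives a Lipschitz bound without any spectral gap.\<close>

lemma polar_factor_lipschitz:
  fixes E :: "real^'n^'n"
  assumes svd: "is_svd (diag s + E) U t V" and c: "0 < c" "\<And>i. c \<le> s $ i"
  defines "W \<equiv> U ** transpose V"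
  shows "c * norm (W - mat 1) \<le> 2 * norm E"
proof -
  let ?D = "W - mat 1" and ?A = "diag s + E"
  have U: "orthogonal_matrix U" and V: "orthogonal_matrix V" and t: "\<And>i. 0 \<le> t $ i"
    and A: "?A = U ** diag t ** transpose V"
    using svd by (auto simp: is_svd_def)
  have W: "orthogonal_matrix W"
    unfolding W_def using U V by (intro orthogonal_matrix_mul) simp_all
  have "W \<bullet> ?A = (U ** mat 1 ** transpose V) \<bullet> (U ** diag t ** transpose V)"
    by (simp add: A W_def)
  also have "\<dots> = (\<Sum>i\<in>UNIV. t $ i)"
    unfolding inner_orthogonal_matrix_mult[OF U V]
    by (simp add: inner_matrix_eq_trace transpose_mat trace_def diag_def)
  finally have 1: "W \<bullet> ?A = (\<Sum>i\<in>UNIV. t $ i)" .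
  have "mat 1 \<bullet> ?A = trace (diag t ** (transpose V ** U))"
    unfolding A using trace_mul_sym[of U "diag t ** transpose V"]
    by (simp add: inner_matrix_eq_trace transpose_mat matrix_mul_assoc)
  also have "\<dots> = (\<Sum>i\<in>UNIV. t $ i * (transpose V ** U) $ i $ i)"
    by (simp add: trace_def diag_mult_nth)
  also have "\<dots> \<le> (\<Sum>i\<in>UNIV. t $ i)"
    using U V t by (intro sum_mono mult_left_le orthogonal_matrix_nth_le_1 orthogonal_matrix_mul)
      simp_all
  finally have "0 \<le> ?D \<bullet> diag s + ?D \<bullet> E"
    using 1 by (simp add: inner_diff_left inner_add_right)
  moreover have "?D \<bullet> diag s = trace (transpose (diag s) ** ?D)"
    by (metis inner_commute inner_matrix_eq_trace)
  moreover have "\<dots> = - (\<Sum>i\<in>UNIV. s $ i * (1 - W $ i $ i))"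
    by (simp add: trace_def diag_mult_nth flip: sum_negf) (simp add: mat_def algebra_simps)
  \<comment> \<open>The deficits \<open>1 - W $ i $ i\<close> are nonnegative, and by the preceding
    lemma on \<open>W - mat 1\<close> they sum to half of its squared norm. So replacing the weights
    \<open>s $ i\<close> by \<open>c\<close> bounds the loss against \<open>diag s\<close> from
    below by \<open>c / 2\<close> times that squared norm.\<close>
  moreover have "c * (\<Sum>i\<in>UNIV. 1 - W $ i $ i) \<le> (\<Sum>i\<in>UNIV. s $ i * (1 - W $ i $ i))"
    unfolding sum_distrib_left
    by (intro sum_mono mult_right_mono c) (simp add: orthogonal_matrix_nth_le_1[OF W])
  moreover have "?D \<bullet> E \<le> norm ?D * norm E"
    by (rule norm_cauchy_schwarz)
  ultimately have "c * (norm ?D)\<^sup>2 \<le> 2 * (norm ?D * norm E)"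
    unfolding norm_orthogonal_matrix_sub_id[OF W] by linarith
  then have "norm ?D * (c * norm ?D) \<le> norm ?D * (2 * norm E)"
    by (simp add: power2_eq_square algebra_simps)
  then show ?thesis
    by (cases "norm ?D = 0") (auto simp: mult_le_cancel_left)
qed

text \<open>The solution \<open>D\<close> of the Sylvester equation
  \<open>diag s ** D + D ** diag s = E - transpose E\<close>, which is the linearised symmetry condition
  for the symmetric polar factor.\<close>

definition sylvester_skew :: "real^'n \<Rightarrow> real^'n^'n \<Rightarrow> real^'n^'n"
  where "sylvester_skew s E = (\<chi> i j. (E $ i $ j - E $ j $ i) / (s $ i + s $ j))"

text \<open>Two exact identities, the symmetry of \<open>transpose W ** (diag s + E)\<close> and the
  orthogonality of \<open>W\<close>, combine to the Sylvester equation with an error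
  \<open>X\<close> of second order.\<close>

lemma polar_factor_linearization:
  fixes E :: "real^'n^'n"
  assumes svd: "is_svd (diag s + E) U t V" and c: "0 < c" "\<And>i. c \<le> s $ i"
  shows "norm (U ** transpose V - mat 1 - sylvester_skew s E)
    \<le> (2 / c\<^sup>2 + 2 * norm (diag s) / c ^ 3) * (norm E)\<^sup>2"
proof -
  define W where "W = U ** transpose V"
  define D where "D = W - mat 1"
  let ?S = "diag s"
  \<comment> \<open>All terms quadratic in \<open>D\<close> and \<open>E\<close>. Using
    orthogonality to eliminate \<open>transpose D ** diag s\<close> from the symmetry condition
    leaves \<open>diag s ** D + D ** diag s = E - transpose E + X\<close>.\<close>
  define X where "X = transpose D ** E - transpose E ** D - transpose D ** D ** ?S"
  have U: "orthogonal_matrix U" and V: "orthogonal_matrix V"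
    and A: "?S + E = U ** diag t ** transpose V"
    using svd by (auto simp: is_svd_def)
  have W: "orthogonal_matrix W"
    unfolding W_def using U V by (intro orthogonal_matrix_mul) simp_all
  have UU: "transpose U ** U = mat 1"
    using U by (simp add: orthogonal_matrix_def)
  have WD: "W = mat 1 + D"
    by (simp add: D_def)
  have tr: "transpose (P + Q) = transpose P + transpose Q" for P Q :: "real^'n^'n"
    by (simp add: transpose_def vec_eq_iff)
  have "transpose W ** (?S + E) = V ** (transpose U ** U) ** diag t ** transpose V"
    unfolding A W_def by (simp add: matrix_transpose_mul matrix_mul_assoc)
  then have "transpose W ** (?S + E) = V ** diag t ** transpose V"
    by (simp add: UU)
  then have "transpose (transpose W ** (?S + E)) = transpose W ** (?S + E)"
    by (simp only: matrix_transpose_mul matrix_mul_assoc transpose_diag transpose_transpose)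
  then have "transpose W ** (?S + E) = (?S + transpose E) ** W"
    by (simp add: matrix_transpose_mul tr)
  then have sym: "transpose D ** ?S + E + transpose D ** E = ?S ** D + transpose E + transpose E ** D"
    unfolding WD by (simp add: tr matrix_add_ldistrib matrix_add_rdistrib transpose_mat algebra_simps)
  have "transpose W ** W = mat 1"
    using W by (simp add: orthogonal_matrix_def)
  then have "transpose D + D + transpose D ** D = 0"
    unfolding WD by (simp add: tr matrix_add_ldistrib matrix_add_rdistrib transpose_mat algebra_simps)
  then have "(transpose D + D + transpose D ** D) ** ?S = 0"
    by simp
  then have "transpose D ** ?S + D ** ?S + transpose D ** D ** ?S = 0"
    by (simp add: matrix_add_rdistrib)
  then have skew: "(transpose D ** ?S + D ** ?S + transpose D ** D ** ?S) $ i $ j = 0" for i j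
    by simp
  have comp: "(s $ i + s $ j) * D $ i $ j = E $ i $ j - E $ j $ i + X $ i $ j" for i j
    using arg_cong[OF sym, of "\<lambda>Y. Y $ i $ j"] skew[of i j]
    by (simp add: X_def diag_mult_nth mult_diag_nth distrib_right)
      (simp add: transpose_def algebra_simps)
  \<comment> \<open>Entrywise the Sylvester operator divides by \<open>s $ i + s $ j\<close>, which
    is at least \<open>2 * c\<close>.\<close>
  have "norm ((D - sylvester_skew s E) $ i $ j) \<le> norm ((X /\<^sub>R (2 * c)) $ i $ j)" for i j
  proof -
    have p: "2 * c \<le> s $ i + s $ j" "0 < s $ i + s $ j"
      using c(2)[of i] c(2)[of j] c(1) by linarith+
    have "(D - sylvester_skew s E) $ i $ j = X $ i $ j / (s $ i + s $ j)"
      using comp[of i j] p(2) by (simp add: sylvester_skew_def field_simps)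
    then have "norm ((D - sylvester_skew s E) $ i $ j) = \<bar>X $ i $ j\<bar> / (s $ i + s $ j)"
      using p(2) by simp
    also have "\<dots> \<le> \<bar>X $ i $ j\<bar> / (2 * c)"
      using p c(1) by (intro divide_left_mono) (simp_all add: mult_pos_pos)
    also have "\<dots> = norm ((X /\<^sub>R (2 * c)) $ i $ j)"
      using c(1) by (simp add: abs_mult field_simps)
    finally show ?thesis .
  qed
  then have "norm (D - sylvester_skew s E) \<le> norm (X /\<^sub>R (2 * c))"
    by (intro norm_le_componentwise_cart) blast
  also have "\<dots> = norm X / (2 * c)"
    using c(1) by (simp add: field_simps)
  finally have 1: "norm (D - sylvester_skew s E) \<le> norm X / (2 * c)" .
  have D: "norm D \<le> 2 * norm E / c"
    using polar_factor_lipschitz[OF svd c] c(1) unfolding D_def W_def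
    by (simp add: pos_le_divide_eq mult.commute)
  \<comment> \<open>Each of the three terms of \<open>X\<close> is estimated with the Lipschitz
    bound \<open>norm D \<le> 2 * norm E / c\<close>; the final division by \<open>2 * c\<close>
    produces the stated constant.\<close>
  have "norm X \<le> norm (transpose D ** E) + norm (transpose E ** D) + norm (transpose D ** D ** ?S)"
    unfolding X_def by (intro order_trans[OF norm_triangle_ineq4] add_right_mono norm_triangle_ineq4)
  moreover have "norm (transpose D ** D ** ?S) \<le> (norm D)\<^sup>2 * norm ?S"
    using norm_matrix_mult_le[of "transpose D ** D" ?S]
      mult_right_mono[OF norm_matrix_mult_le[of "transpose D" D], of "norm ?S"]
    by (simp add: norm_transpose power2_eq_square)
  moreover have "norm (transpose D ** E) \<le> norm D * norm E"
    using norm_matrix_mult_le[of "transpose D" E] by (simp add: norm_transpose)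
  moreover have "norm (transpose E ** D) \<le> norm D * norm E"
    using norm_matrix_mult_le[of "transpose E" D] by (simp add: norm_transpose mult.commute)
  moreover have "(norm D)\<^sup>2 * norm ?S \<le> (2 * norm E / c)\<^sup>2 * norm ?S"
    using D by (intro mult_right_mono power_mono) simp_all
  moreover have "norm D * norm E \<le> (2 * norm E / c) * norm E"
    using D by (intro mult_right_mono) simp_all
  ultimately have "norm X \<le> 2 * ((2 * norm E / c) * norm E) + (2 * norm E / c)\<^sup>2 * norm ?S"
    by linarith
  then have "norm X / (2 * c) \<le>
      (2 * ((2 * norm E / c) * norm E) + (2 * norm E / c)\<^sup>2 * norm ?S) / (2 * c)"
    using c(1) by (intro divide_right_mono) simp_all
  also have "\<dots> = (2 / c\<^sup>2 + 2 * norm ?S / c ^ 3) * (norm E)\<^sup>2"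
    using c(1) by (simp add: field_simps power2_eq_square power3_eq_cube)
  finally show ?thesis
    using 1 by (simp add: D_def W_def)
qed

lemma linear_sylvester_skew: "linear (sylvester_skew s)"
  by (rule linearI) (simp_all add: sylvester_skew_def vec_eq_iff add_divide_distrib
      diff_divide_distrib algebra_simps)

section \<open>Transfer from the diagonal case to an arbitrary invertible matrix\<close>

lemma continuous_det: "continuous_on UNIV (det :: real^'n^'n \<Rightarrow> real)"
  unfolding det_def by (intro continuous_intros)

lemma is_svd_orthogonal_mult:
  fixes A U V :: "real^'n^'n"
  assumes "is_svd A U s V" and P: "orthogonal_matrix P" and Q: "orthogonal_matrix Q"
  shows "is_svd (P ** A ** Q) (P ** U) s (transpose Q ** V)"
  using assms by (simp add: is_svd_def orthogonal_matrix_mul matrix_mul_assoc matrix_transpose_mul)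

text \<open>Rotate the direction \<open>H\<close> into the frame where the base matrix is
  \<open>diag s\<close>, solve the Sylvester equation there, and rotate back.\<close>

definition polar_derivative :: "real^'n^'n \<Rightarrow> real^'n \<Rightarrow> real^'n^'n \<Rightarrow> real^'n^'n \<Rightarrow> real^'n^'n"
  where "polar_derivative U s V H =
    U ** sylvester_skew s (transpose U ** H ** V) ** transpose V"

lemma linear_polar_derivative: "linear (polar_derivative U s V)"
proof -
  have 1: "linear ((**) A)" "linear (\<lambda>X. X ** A)" for A :: "real^'n^'n"
    using bounded_bilinear_matrix_mult
    by (auto intro: bounded_linear.linear bounded_bilinear.bounded_linear_right
        bounded_bilinear.bounded_linear_left)
  have "polar_derivative U s V = (\<lambda>X. X ** transpose V) \<circ> (**) U \<circ> sylvester_skew s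
      \<circ> (\<lambda>X. X ** V) \<circ> (**) (transpose U)"
    by (simp add: fun_eq_iff polar_derivative_def)
  then show ?thesis
    by (metis 1 linear_sylvester_skew linear_compose)
qed

lemma svd_det_nonzero_imp_pos:
  assumes "is_svd A U s V" "det A \<noteq> 0"
  shows "0 < s $ i"
proof -
  have "(\<Prod>i\<in>UNIV. s $ i) \<noteq> 0"
    using assms by (auto simp: is_svd_def det_mul det_diag)
  then show ?thesis
    using assms(1) by (auto simp: is_svd_def order_less_le)
qed

text \<open>The polar factor commutes with orthogonal multiplication on either side and the norm is
  unchanged by it, so the second-order bound for \<open>diag s + E\<close> carries over to
  \<open>M\<close>.\<close>

lemma has_derivative_polar_rotation:
  assumes svd: "is_svd M U s V" and det: "det M \<noteq> 0"
  shows "(polar_rotation has_derivative polar_derivative U s V) (at M)"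
proof -
  have U: "orthogonal_matrix U" and V: "orthogonal_matrix V" and M: "M = U ** diag s ** transpose V"
    using svd by (auto simp: is_svd_def)
  have inv: "transpose U ** U = mat 1" "U ** transpose U = mat 1"
    "transpose V ** V = mat 1" "V ** transpose V = mat 1"
    using U V by (auto simp: orthogonal_matrix_def)
  \<comment> \<open>The smallest singular value of \<open>M\<close>. Since \<open>c\<close> and
    \<open>K\<close> depend on \<open>M\<close> alone, the remainder bound is uniform over nearby
    \<open>X\<close>.\<close>
  define c where "c = Min (range (($) s))"
  have c: "0 < c" "\<And>i. c \<le> s $ i"
    using svd_det_nonzero_imp_pos[OF svd det] by (auto simp: c_def)
  define K where "K = 2 / c\<^sup>2 + 2 * norm (diag s) / c ^ 3"
  have "open {X :: real^3^3. det X \<noteq> 0}"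
    by (intro open_Collect_neq continuous_det continuous_intros)
  then obtain e where e: "0 < e" "\<And>X. dist X M < e \<Longrightarrow> det X \<noteq> 0"
    using det by (auto simp: open_dist)
  have bound: "norm (polar_rotation X - polar_rotation M - polar_derivative U s V (X - M))
      \<le> K * (norm (X - M))\<^sup>2" if X: "dist X M < e" for X
  proof -
    \<comment> \<open>Any decomposition of \<open>X\<close> will do, so no continuous choice of
      singular vectors is involved.\<close>
    obtain U' t V' where svd': "is_svd X U' t V'"
      using invertible_svd_exists e(2)[OF X] by blast
    define E where "E = transpose U ** (X - M) ** V"
    have "transpose U ** M ** V = (transpose U ** U) ** diag s ** (transpose V ** V)"
      by (simp only: M matrix_mul_assoc)
    then have E: "diag s + E = transpose U ** X ** V"
      by (simp add: E_def matrix_diff_conj inv)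
    have svdE: "is_svd (diag s + E) (transpose U ** U') t (transpose V ** V')"
      unfolding E using is_svd_orthogonal_mult[OF svd', of "transpose U" V] U V by simp
    let ?W = "(transpose U ** U') ** transpose (transpose V ** V')"
    have "U ** ?W ** transpose V = (U ** transpose U) ** U' ** transpose V' ** (V ** transpose V)"
      by (simp only: matrix_mul_assoc matrix_transpose_mul transpose_transpose)
    then have "polar_rotation X = U ** ?W ** transpose V"
      using polar_rotation_eqI[OF e(2)[OF X] svd'] by (simp add: inv)
    moreover have "polar_rotation M = U ** mat 1 ** transpose V"
      using polar_rotation_eqI[OF det svd] by simp
    ultimately have "polar_rotation X - polar_rotation M - polar_derivative U s V (X - M) =
        U ** (?W - mat 1 - sylvester_skew s E) ** transpose V"
      by (simp only: polar_derivative_def E_def matrix_diff_conj)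
    moreover have "norm E = norm (X - M)"
      using norm_orthogonal_matrix_mult[of "transpose U" "transpose V" "X - M"] U V by (simp add: E_def)
    ultimately show ?thesis
      using polar_factor_linearization[OF svdE c] by (simp add: norm_orthogonal_matrix_mult[OF U V] K_def)
  qed
  show ?thesis
  proof (rule has_derivativeI_sandwich[OF e(1)])
    show "bounded_linear (polar_derivative U s V)"
      by (simp add: linear_conv_bounded_linear[symmetric] linear_polar_derivative)
    have "((\<lambda>X. K * norm (X - M)) \<longlongrightarrow> K * norm (M - M)) (at M)"
      by (intro tendsto_intros)
    then show "((\<lambda>X. K * norm (X - M)) \<longlongrightarrow> 0) (at M)"
      by simp
  next
    fix X assume "X \<noteq> M" "dist X M < e"
    then show "norm (polar_rotation X - polar_rotation M - polar_derivative U s V (X - M)) / norm (X - M)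
        \<le> K * norm (X - M)"
      using bound[of X] by (simp add: divide_le_eq power2_eq_square mult.assoc)
  qed
qed


section \<open>Rank, kernel and spectral norm from a decomposition\<close>

lemma norm_orthogonal_matrix_vector:
  fixes U :: "real^'n^'n"
  assumes "orthogonal_matrix U"
  shows "norm (U *v x) = norm x"
  using assms orthogonal_transformation_matrix[of "(*v) U"]
  by (simp add: orthogonal_transformation_norm)

lemma inj_orthogonal_matrix_vector:
  fixes U :: "real^'n^'n"
  assumes "orthogonal_matrix U"
  shows "inj ((*v) U)"
  using assms unfolding orthogonal_matrix by (intro matrix_left_invertible_injective[THEN iffD1]) blast

lemma dim_orthogonal_matrix_image:
  fixes U :: "real^'n^'n"
  assumes "orthogonal_matrix U"
  shows "dim ((*v) U ` S) = dim S"
  by (rule dim_image_eq) (use inj_orthogonal_matrix_vector[OF assms] in \<open>auto intro: inj_on_subset\<close>)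

lemma dim_coordinate_subspace: "dim {x :: real^'n. \<forall>i. i \<notin> d \<longrightarrow> x $ i = 0} = card d"
  using dim_substandard_cart[of d, where 'a = real] by (simp add: dim_vec_eq)

lemma diag_mult_vector_nth: "(diag s *v x) $ i = s $ i * x $ i"
proof -
  have "(diag s *v x) $ i = (\<Sum>j\<in>UNIV. if i = j then s $ i * x $ j else 0)"
    unfolding diag_def matrix_vector_mult_def vec_lambda_beta by (rule sum.cong) auto
  then show ?thesis by simp
qed

text \<open>\<open>V\<close> maps the coordinate subspace on which \<open>diag s\<close> vanishes
  isomorphically onto the kernel of \<open>A\<close>.\<close>

lemma svd_dim_kernel:
  fixes A :: "real^'n^'n"
  assumes "is_svd A U s V"
  shows "dim {x. A *v x = 0} = card {i. s $ i = 0}"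
proof -
  have U: "orthogonal_matrix U" and V: "orthogonal_matrix V" and A: "A = U ** diag s ** transpose V"
    using assms by (auto simp: is_svd_def)
  have V': "transpose V *v (V *v x) = x" "V *v (transpose V *v x) = x" for x
    using V by (simp_all only: matrix_vector_mul_assoc orthogonal_matrix_def matrix_vector_mul_lid)
  have "A *v x = U *v (diag s *v (transpose V *v x))" for x
    by (simp only: A matrix_vector_mul_assoc matrix_mul_assoc)
  moreover have "U *v y = 0 \<longleftrightarrow> y = 0" for y
    using norm_orthogonal_matrix_vector[OF U, of y] by (metis norm_eq_zero)
  ultimately have k: "A *v x = 0 \<longleftrightarrow> diag s *v (transpose V *v x) = 0" for x
    by metis
  have "{x. A *v x = 0} = (*v) V ` {y. diag s *v y = 0}"
    using V' k by (auto intro!: image_eqI simp del: transpose_matrix_vector)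
  also have "{y. diag s *v y = 0} = {y. \<forall>i. i \<notin> {i. s $ i = 0} \<longrightarrow> y $ i = 0}"
    by (auto simp: vec_eq_iff diag_mult_vector_nth)
  finally show ?thesis
    by (simp only: dim_orthogonal_matrix_image[OF V] dim_coordinate_subspace)
qed

text \<open>As \<open>transpose V\<close> is onto, the range of \<open>A\<close> is the image under
  \<open>U\<close> of the coordinate subspace belonging to the nonzero entries of
  \<open>s\<close>.\<close>

lemma svd_rank:
  fixes A :: "real^'n^'n"
  assumes "is_svd A U s V"
  shows "rank A = card {i. s $ i \<noteq> 0}"
proof -
  have U: "orthogonal_matrix U" and V: "orthogonal_matrix V" and A: "A = U ** diag s ** transpose V"
    using assms by (auto simp: is_svd_def)
  have surj: "surj ((*v) (transpose V))"
    using V unfolding orthogonal_matrix_def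
    by (intro matrix_right_invertible_surjective[THEN iffD1]) blast
  have "(*v) A = (*v) U \<circ> (*v) (diag s) \<circ> (*v) (transpose V)"
    by (rule ext) (simp only: A comp_apply matrix_vector_mul_assoc matrix_mul_assoc)
  then have "range ((*v) A) = (*v) U ` range ((*v) (diag s))"
    by (simp only: image_comp[symmetric] surj)
  also have "range ((*v) (diag s)) = {y. \<forall>i. i \<notin> {i. s $ i \<noteq> 0} \<longrightarrow> y $ i = 0}"
  proof safe
    fix y :: "real^'n" assume y: "\<forall>i. i \<notin> {i. s $ i \<noteq> 0} \<longrightarrow> y $ i = 0"
    show "y \<in> range ((*v) (diag s))"
      \<comment> \<open>Where \<open>s $ i = 0\<close> the quotient is a harmless default: it is
        multiplied by \<open>s $ i\<close>, and \<open>y $ i\<close> is zero there as well.\<close>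
      by (rule range_eqI[of _ _ "\<chi> i. y $ i / s $ i"])
        (use y in \<open>auto simp: vec_eq_iff diag_mult_vector_nth\<close>)
  qed (auto simp: diag_mult_vector_nth)
  finally show ?thesis
    by (simp only: rank_dim_range dim_orthogonal_matrix_image[OF U] dim_coordinate_subspace)
qed

text \<open>Orthogonal factors preserve norms, so only \<open>diag s\<close> matters. The bound is
  attained at \<open>V *v axis k 1\<close>, where \<open>k\<close> is the index of a largest
  entry.\<close>

lemma svd_spectral_norm:
  fixes A :: "real^'n^'n"
  assumes "is_svd A U s V"
  shows "spectral_norm A = Max (range (($) s))"
proof -
  have U: "orthogonal_matrix U" and V: "orthogonal_matrix V" and A: "A = U ** diag s ** transpose V"
    and s: "\<And>i. 0 \<le> s $ i"
    using assms by (auto simp: is_svd_def)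
  define m where "m = Max (range (($) s))"
  have "m \<in> range (($) s)"
    unfolding m_def by (rule Max_in) auto
  then obtain k where k: "m = s $ k"
    by blast
  have norm_A: "norm (A *v x) = norm (diag s *v (transpose V *v x))" for x
    by (metis A matrix_vector_mul_assoc norm_orthogonal_matrix_vector[OF U])
  have "norm (A *v x) \<le> m * norm x" for x
  proof -
    have "s $ i \<le> \<bar>m\<bar>" for i
      unfolding m_def by (intro order_trans[OF Max_ge abs_ge_self]) auto
    then have "norm (diag s *v y) \<le> norm (m *\<^sub>R y)" for y :: "real^'n"
      by (intro norm_le_componentwise_cart)
        (auto simp: diag_mult_vector_nth abs_mult s intro!: mult_right_mono)
    then have "norm (A *v x) \<le> \<bar>m\<bar> * norm (transpose V *v x)"
      unfolding norm_A norm_scaleR .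
    then show ?thesis
      using V k s by (simp add: norm_orthogonal_matrix_vector del: transpose_matrix_vector)
  qed
  then have "spectral_norm A \<le> m"
    unfolding spectral_norm_def by (rule onorm_le)
  moreover have "m \<le> spectral_norm A"
  proof -
    have "transpose V *v (V *v axis k 1) = axis k (1 :: real)"
      using V by (simp only: matrix_vector_mul_assoc orthogonal_matrix_def matrix_vector_mul_lid)
    then have "norm (A *v (V *v axis k 1)) = norm (m *\<^sub>R axis k (1 :: real))"
      unfolding norm_A by (intro arg_cong[of _ _ norm])
        (simp add: vec_eq_iff diag_mult_vector_nth axis_def k)
    then have "m = norm (A *v (V *v axis k 1))"
      using s by (simp add: k)
    also have "\<dots> \<le> spectral_norm A * norm (V *v axis k (1 :: real))"
      unfolding spectral_norm_def by (intro onorm matrix_vector_mul_bounded_linear)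
    finally show ?thesis
      by (simp add: norm_orthogonal_matrix_vector[OF V])
  qed
  ultimately show ?thesis
    unfolding m_def[symmetric] by (rule antisym)
qed


section \<open>Singular value decomposition of the Jacobian\<close>

text \<open>Chooses one of \<open>(i, j)\<close> and \<open>(j, i)\<close> for distinct
  \<open>i\<close> and \<open>j\<close>. The chosen pair will index a skew basis matrix, the other
  one its symmetric companion.\<close>

definition upper_pairs :: "(3 \<times> 3) set"
  where "upper_pairs = {(1, 2), (1, 3), (2, 3)}"

text \<open>Orthonormal eigenvectors of \<open>sylvester_skew s\<close>, the same for all \<open>s\<close>.\<close>

definition skew_sym_basis :: "3 \<times> 3 \<Rightarrow> real^3^3"
  where "skew_sym_basis = (\<lambda>(i, j).
    if i = j then axis i (axis i 1)
    else if (i, j) \<in> upper_pairs then (axis i (axis j 1) - axis j (axis i 1)) /\<^sub>R sqrt 2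
    else (axis i (axis j 1) + axis j (axis i 1)) /\<^sub>R sqrt 2)"

text \<open>The eigenvalues of \<open>sylvester_skew s\<close> on \<open>skew_sym_basis\<close>,
  which turn out to be the singular values of the Jacobian.\<close>

definition polar_gain :: "real^3 \<Rightarrow> real^(3 \<times> 3)"
  where "polar_gain s = (\<chi> p. if p \<in> upper_pairs then 2 / (s $ fst p + s $ snd p) else 0)"

lemma upper_pairs_swap: "(j, i) \<in> upper_pairs \<longleftrightarrow> i \<noteq> j \<and> (i, j) \<notin> upper_pairs"
proof -
  have "\<forall>i j. (j, i) \<in> upper_pairs \<longleftrightarrow> i \<noteq> j \<and> (i, j) \<notin> upper_pairs"
    unfolding forall_3 by (simp add: upper_pairs_def)
  then show ?thesis by blast
qed

lemma skew_sym_basis_orthonormal: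
  "skew_sym_basis p \<bullet> skew_sym_basis q = (if p = q then 1 else 0)"
proof -
  have E: "axis i (axis j (1 :: real)) \<bullet> axis k (axis l 1) = (if i = k \<and> j = l then 1 else 0)"
    for i j k l :: 3
    by (simp add: inner_axis_axis)
  obtain i j k l where pq: "p = (i, j)" "q = (k, l)"
    by fastforce
  \<comment> \<open>For transposed pairs one matrix is skew and the other symmetric, so the two
    products cancel; in the last case the supports are disjoint.\<close>
  consider "p = q" | "p \<noteq> q" "(k, l) = (j, i)" | "p \<noteq> q" "(k, l) \<noteq> (j, i)" by blast
  then show ?thesis
  proof cases
    case 1
    then show ?thesis
      using upper_pairs_swap[of j i]
      by (simp add: pq skew_sym_basis_def E inner_diff_left inner_diff_right inner_add_left
          inner_add_right field_simps)
  next
    case 2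
    then show ?thesis
      using upper_pairs_swap[of j i]
      by (auto simp: pq skew_sym_basis_def E inner_diff_left inner_diff_right inner_add_left
          inner_add_right)
  next
    case 3
    then show ?thesis
      by (auto simp: pq skew_sym_basis_def E inner_diff_left inner_diff_right inner_add_left
          inner_add_right)
  qed
qed

text \<open>Each basis matrix is supported on one unordered index pair, where the denominator is
  constant; \<open>E - transpose E\<close> doubles the skew ones and kills the symmetric
  ones.\<close>

lemma sylvester_skew_basis:
  "sylvester_skew s (skew_sym_basis p) = polar_gain s $ p *\<^sub>R skew_sym_basis p"
proof -
  have "\<forall>p. sylvester_skew s (skew_sym_basis p) = polar_gain s $ p *\<^sub>R skew_sym_basis p"
    unfolding skew_sym_basis_def split_paired_All forall_3 sylvester_skew_def polar_gain_def
    by (simp add: upper_pairs_def vec_eq_iff forall_3 axis_def add.commute)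
  then show ?thesis by blast
qed

section \<open>Passage from matrices to vectors in nine dimensions\<close>

lemma inner_vec_of_mat: "vec_of_mat A \<bullet> vec_of_mat B = A \<bullet> B"
  by (simp add: vec_of_mat_def inner_vec_def sum.cartesian_product case_prod_unfold
      flip: UNIV_Times_UNIV)

lemma linear_vec_of_mat: "linear vec_of_mat"
  by (rule linearI) (simp_all add: vec_of_mat_def vec_eq_iff)

lemma linear_mat_of_vec: "linear mat_of_vec"
  by (rule linearI) (simp_all add: mat_of_vec_def vec_eq_iff)

lemma has_derivative_vec_polar_rotation:
  assumes "is_svd M U s V" "det M \<noteq> 0"
  shows "(vec_polar_rotation has_derivative
    (\<lambda>h. vec_of_mat (polar_derivative U s V (mat_of_vec h)))) (at (vec_of_mat M))"
proof -
  have 1: "(mat_of_vec has_derivative mat_of_vec) (at (vec_of_mat M))"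
    and 2: "(vec_of_mat has_derivative vec_of_mat) (at (polar_rotation M))"
    using linear_vec_of_mat linear_mat_of_vec
    by (simp_all add: linear_conv_bounded_linear bounded_linear_imp_has_derivative)
  have 3: "(polar_rotation \<circ> mat_of_vec has_derivative polar_derivative U s V \<circ> mat_of_vec)
      (at (vec_of_mat M))"
    using has_derivative_polar_rotation[OF assms] by (intro diff_chain_at 1) simp
  have "(vec_of_mat \<circ> (polar_rotation \<circ> mat_of_vec) has_derivative
      vec_of_mat \<circ> (polar_derivative U s V \<circ> mat_of_vec)) (at (vec_of_mat M))"
    using 2 by (intro diff_chain_at[OF 3]) simp
  then show ?thesis
    by (simp add: comp_def vec_polar_rotation_def[abs_def])
qed

lemma J_SVD_mult:
  assumes "is_svd M U s V" "det M \<noteq> 0"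
  shows "J_SVD M *v x = vec_of_mat (polar_derivative U s V (mat_of_vec x))"
proof -
  have "vec_polar_rotation differentiable (at (vec_of_mat M))"
    using has_derivative_vec_polar_rotation[OF assms] by (rule differentiableI)
  then have "(vec_polar_rotation has_derivative (*v) (J_SVD M)) (at (vec_of_mat M))"
    unfolding J_SVD_def jacobian_works .
  then show ?thesis
    using has_derivative_unique[OF has_derivative_vec_polar_rotation[OF assms]] by metis
qed

text \<open>Conjugation by \<open>U\<close> and \<open>V\<close> and vectorisation are isometries,
  so they turn \<open>skew_sym_basis\<close> into an orthonormal eigenbasis of the Jacobian. The
  eigenvalues are nonnegative, hence the same \<open>Q\<close> serves as left and right
  factor.\<close>

lemma J_SVD_svd:
  assumes svd: "is_svd M U s V" and det: "det M \<noteq> 0"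
  obtains Q where "is_svd (J_SVD M) Q (polar_gain s) Q"
proof -
  have U: "orthogonal_matrix U" and V: "orthogonal_matrix V"
    using svd by (auto simp: is_svd_def)
  define q where "q p = vec_of_mat (U ** skew_sym_basis p ** transpose V)" for p
  have q: "q i \<bullet> q j = (if i = j then 1 else 0)" for i j
    by (simp add: q_def inner_vec_of_mat inner_orthogonal_matrix_mult[OF U V] skew_sym_basis_orthonormal)
  have "transpose U ** (U ** X ** transpose V) ** V = X" for X
  proof -
    have "transpose U ** (U ** X ** transpose V) ** V =
        (transpose U ** U) ** X ** (transpose V ** V)"
      by (simp only: matrix_mul_assoc)
    then show ?thesis
      using U V by (simp add: orthogonal_matrix_def)
  qed
  then have Jq: "J_SVD M *v q p = polar_gain s $ p *\<^sub>R q p" for p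
    using linear_scale[OF linear_vec_of_mat]
    by (simp add: q_def J_SVD_mult[OF svd det] polar_derivative_def sylvester_skew_basis
        matrix_scalar_ac flip: scalar_matrix_assoc)
  have "0 \<le> polar_gain s $ p" for p
    using svd by (auto simp: polar_gain_def is_svd_def)
  then show ?thesis
    using columns_eq_imp_svd[OF q q Jq] that by blast
qed


section \<open>Tangent spaces of the rotation group\<close>

text \<open>The matrix of the cross product with \<open>w\<close>; it identifies the skew matrices
  with a three-dimensional space.\<close>

definition skew3 :: "real^3 \<Rightarrow> real^3^3"
  where "skew3 w = vector [vector [0, - w $ 3, w $ 2], vector [w $ 3, 0, - w $ 1],
    vector [- w $ 2, w $ 1, 0]]"

lemma skew3_surj:
  assumes "transpose A = - A"
  shows "A = skew3 (vector [A $ 3 $ 2, A $ 1 $ 3, A $ 2 $ 1])"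
proof -
  have "A $ j $ i = - A $ i $ j" for i j
    using arg_cong[OF assms, of "\<lambda>X. X $ i $ j"] by (simp add: transpose_def)
  from this[of 1 1] this[of 2 2] this[of 3 3] this[of 1 2] this[of 1 3] this[of 2 3]
  show ?thesis
    by (simp add: skew3_def vec_eq_iff forall_3)
qed

lemma linear_skew3: "linear skew3"
  by (rule linearI) (simp_all add: skew3_def vec_eq_iff forall_3)

lemma inj_skew3: "inj skew3"
  by (rule injI) (simp add: skew3_def vec_eq_iff forall_3)

text \<open>Positivity of this determinant for every \<open>t\<close> keeps the curve used below
  inside the domain of the rotation factor.\<close>

lemma det_id_plus_skew3: "det (mat 1 + t *\<^sub>R skew3 w) = 1 + t\<^sup>2 * (w \<bullet> w)"
  by (simp add: det_3 skew3_def mat_def inner_vec_def sum_3 power2_eq_square algebra_simps)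

text \<open>The determinant of \<open>N\<close> is that of its orthogonal factor times a nonnegative
  product, so the orthogonal factor has positive determinant, which must be 1.\<close>

lemma polar_rotation_SO3:
  assumes "det N > 0"
  shows "polar_rotation N \<in> SO3"
proof -
  obtain U s V where svd: "is_svd N U s V"
    using invertible_svd_exists assms by (metis order_less_irrefl)
  have U: "orthogonal_matrix U" and V: "orthogonal_matrix V" and N: "N = U ** diag s ** transpose V"
    and s: "\<And>i. 0 \<le> s $ i"
    using svd by (auto simp: is_svd_def)
  have R: "orthogonal_matrix (U ** transpose V)"
    using U V by (intro orthogonal_matrix_mul) simp_all
  have "det N = det (U ** transpose V) * (\<Prod>i\<in>UNIV. s $ i)"
    by (simp add: N det_mul det_diag)
  moreover have "0 \<le> (\<Prod>i\<in>UNIV. s $ i)"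
    by (intro prod_nonneg) (simp add: s)
  ultimately have "0 < det (U ** transpose V)"
    using assms by (simp add: zero_less_mult_iff)
  then have "det (U ** transpose V) = 1"
    using det_orthogonal_matrix[OF R] by auto
  then show ?thesis
    using R polar_rotation_eqI[OF _ svd] assms by (simp add: SO3_def)
qed

text \<open>The rotation factor of \<open>Q (I + t A)\<close>, \<open>A\<close> skew, is a curve in \<open>SO3\<close> with velocity \<open>Q A\<close>,
  so no matrix exponential is needed.\<close>

lemma tangent_space_SO3:
  assumes Q: "Q \<in> SO3"
  shows "tangent_space SO3 Q = range (\<lambda>w. Q ** skew3 w)"
proof safe
  have oQ: "orthogonal_matrix Q" and dQ: "det Q = 1"
    using Q by (auto simp: SO3_def)
  {
    fix v assume "v \<in> tangent_space SO3 Q"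
    then obtain \<gamma> where \<gamma>: "\<And>t. \<gamma> t \<in> SO3" "\<gamma> 0 = Q" "(\<gamma> has_vector_derivative v) (at 0)"
      by (auto simp: tangent_space_def)
    have "((\<lambda>t. transpose (\<gamma> t)) has_vector_derivative transpose v) (at 0)"
      by (intro bounded_linear.has_vector_derivative[OF bounded_linear_transpose] \<gamma>)
    \<comment> \<open>Differentiating the constant product
      \<open>transpose (\<gamma> t) ** \<gamma> t\<close> shows that \<open>transpose Q ** v\<close>
      is skew.\<close>
    then have "((\<lambda>t. transpose (\<gamma> t) ** \<gamma> t) has_vector_derivative
        (transpose (\<gamma> 0) ** v + transpose v ** \<gamma> 0)) (at 0)"
      by (intro bounded_bilinear.has_vector_derivative[OF bounded_bilinear_matrix_mult] \<gamma>)
    moreover have "transpose (\<gamma> t) ** \<gamma> t = mat 1" for t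
      using \<gamma>(1)[of t] by (simp add: SO3_def orthogonal_matrix_def)
    ultimately have "((\<lambda>t. mat 1) has_vector_derivative (transpose Q ** v + transpose v ** Q))
        (at (0 :: real))"
      by (simp add: \<gamma>(2))
    then have "transpose Q ** v + transpose v ** Q = 0"
      using vector_derivative_unique_at[OF _ has_vector_derivative_const] by blast
    then have "transpose (transpose Q ** v) = - (transpose Q ** v)"
      by (simp add: matrix_transpose_mul eq_neg_iff_add_eq_0 add.commute)
    from skew3_surj[OF this] obtain w where "transpose Q ** v = skew3 w" by blast
    then have "Q ** skew3 w = (Q ** transpose Q) ** v"
      by (simp add: matrix_mul_assoc[symmetric])
    then show "v \<in> range (\<lambda>w. Q ** skew3 w)"
      using oQ by (auto simp: orthogonal_matrix_def)
  }
  {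
    fix w
    define N where "N t = Q ** (mat 1 + t *\<^sub>R skew3 w)" for t :: real
    have N: "N t = Q + t *\<^sub>R (Q ** skew3 w)" for t
      by (simp add: N_def matrix_add_ldistrib matrix_scalar_ac flip: scalar_matrix_assoc)
    have "1 + t\<^sup>2 * (w \<bullet> w) > 0" for t
      by (intro add_pos_nonneg) simp_all
    then have in_SO3: "polar_rotation (N t) \<in> SO3" for t
      by (intro polar_rotation_SO3) (simp add: N_def det_mul dQ det_id_plus_skew3)
    have one: "diag (\<chi> i. 1) = (mat 1 :: real^3^3)"
      by (simp add: diag_def mat_def vec_eq_iff)
    have svd: "is_svd Q Q (\<chi> i. 1) (mat 1)"
      using oQ by (simp add: is_svd_def one orthogonal_matrix_id transpose_mat)
    then have "polar_rotation Q = Q"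
      using polar_rotation_eqI[OF _ svd] dQ by (simp add: transpose_mat)
    then have at0: "polar_rotation (N 0) = Q"
      by (simp add: N)
    have "(N has_derivative (\<lambda>t. t *\<^sub>R (Q ** skew3 w))) (at 0)"
      unfolding N[abs_def] by (auto intro!: derivative_eq_intros)
    moreover have "(polar_rotation has_derivative polar_derivative Q (\<chi> i. 1) (mat 1)) (at (N 0))"
      using has_derivative_polar_rotation[OF svd] dQ by (simp add: N)
    ultimately have "(polar_rotation \<circ> N has_derivative
        polar_derivative Q (\<chi> i. 1) (mat 1) \<circ> (\<lambda>t. t *\<^sub>R (Q ** skew3 w))) (at 0)"
      by (rule diff_chain_at)
    then have "((polar_rotation \<circ> N) has_vector_derivative
        polar_derivative Q (\<chi> i. 1) (mat 1) (Q ** skew3 w)) (at 0)"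
      by (simp add: has_vector_derivative_def comp_def linear_scale[OF linear_polar_derivative])
    moreover have "polar_derivative Q (\<chi> i. 1) (mat 1) (Q ** skew3 w) = Q ** skew3 w"
    proof -
      have "transpose Q ** (Q ** skew3 w) = skew3 w"
        using oQ by (simp add: matrix_mul_assoc orthogonal_matrix_def)
      \<comment> \<open>With all singular values 1 the Sylvester solution is the skew part of its
        argument, which fixes skew matrices.\<close>
      moreover have "sylvester_skew (\<chi> i. 1) (skew3 w) = skew3 w"
        by (simp add: sylvester_skew_def skew3_def vec_eq_iff forall_3)
      ultimately show ?thesis
        by (simp add: polar_derivative_def transpose_mat)
    qed
    ultimately show "Q ** skew3 w \<in> tangent_space SO3 Q"
      unfolding tangent_space_def using in_SO3 at0
      by (auto intro!: exI[of _ "polar_rotation \<circ> N"])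
  }
qed

lemma dim_tangent_space_SO3:
  assumes Q: "Q \<in> SO3"
  shows "dim (tangent_space SO3 Q) = 3"
proof -
  have lin: "linear (\<lambda>w. Q ** skew3 w)"
    using linear_skew3 by (auto intro!: linearI
      simp: linear_add linear_scale matrix_add_ldistrib matrix_scalar_ac scalar_matrix_assoc)
  have QQ: "transpose Q ** Q = mat 1"
    using Q by (simp add: SO3_def orthogonal_matrix_def)
  have inj: "inj (\<lambda>w. Q ** skew3 w)"
  proof (rule injI)
    fix x y assume "Q ** skew3 x = Q ** skew3 y"
    then have "(transpose Q ** Q) ** skew3 x = (transpose Q ** Q) ** skew3 y"
      by (simp add: matrix_mul_assoc[symmetric])
    then show "x = y"
      using inj_skew3 by (simp add: QQ inj_eq)
  qed
  show ?thesis
    unfolding tangent_space_SO3[OF Q]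
    using dim_image_eq[OF lin, of UNIV] inj by simp
qed


section \<open>Singular values and condition number of the Jacobian\<close>

lemma UNIV_3_Times_3: "(UNIV :: (3 \<times> 3) set) =
    {(1, 2), (1, 3), (2, 3), (1, 1), (2, 2), (3, 3), (2, 1), (3, 1), (3, 2)}"
  unfolding UNIV_Times_UNIV[symmetric] UNIV_3 by auto

lemma mset_polar_gain:
  "image_mset (($) (polar_gain (vector [s1, s2, s3]))) (mset_set UNIV) =
    {#2 / (s1 + s2), 2 / (s1 + s3), 2 / (s2 + s3), 0, 0, 0, 0, 0, 0#}"
  unfolding UNIV_3_Times_3 by (simp add: polar_gain_def upper_pairs_def)

lemma J_SVD_singular_values:
  assumes "det M > 0" "is_svd M U (vector [s1, s2, s3]) V"
  shows "singular_values (J_SVD M) =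
    {#2 / (s1 + s2), 2 / (s1 + s3), 2 / (s2 + s3), 0, 0, 0, 0, 0, 0#}"
proof -
  obtain Q where "is_svd (J_SVD M) Q (polar_gain (vector [s1, s2, s3])) Q"
    using J_SVD_svd[OF assms(2)] assms(1) by (metis order_less_irrefl)
  then show ?thesis
    using singular_values_eqI mset_polar_gain by metis
qed

text \<open>Kept separate because the growth estimate applies it pointwise along a family of
  matrices. The largest gain belongs to the smallest sum, \<open>s2 + s3\<close>.\<close>

lemma J_SVD_spectral_norm:
  assumes "det M > 0" "is_svd M U (vector [s1, s2, s3]) V" "s1 > s2" "s2 > s3" "s3 > 0"
  shows "spectral_norm (J_SVD M) = 2 / (s2 + s3)"
proof -
  let ?g = "polar_gain (vector [s1, s2, s3])"
  obtain Q where "is_svd (J_SVD M) Q ?g Q"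
    using J_SVD_svd[OF assms(2)] assms(1) by (metis order_less_irrefl)
  then have "spectral_norm (J_SVD M) = Max (range (($) ?g))"
    by (rule svd_spectral_norm)
  also have "range (($) ?g) = {2 / (s1 + s2), 2 / (s1 + s3), 2 / (s2 + s3), 0}"
    unfolding UNIV_3_Times_3 by (auto simp: polar_gain_def upper_pairs_def)
  also have "Max \<dots> = 2 / (s2 + s3)"
    using assms by (intro Max_eqI) (auto intro!: divide_left_mono)
  finally show ?thesis .
qed

theorem theorem1:
  fixes M U V :: "real^3^3" and s1 s2 s3 :: real
  assumes "det M > 0"
    and "is_svd M U (vector [s1, s2, s3]) V"
    and "s1 > s2" and "s2 > s3" and "s3 > 0"
  shows "vec_polar_rotation differentiable (at (vec_of_mat M)) \<and>
    rank (J_SVD M) = 3 \<and>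
    (\<forall>Q\<in>SO3. dim (tangent_space SO3 Q) = 3) \<and>
    dim {x. J_SVD M *v x = 0} = 6 \<and>
    singular_values (J_SVD M) =
      {#2 / (s1 + s2), 2 / (s1 + s3), 2 / (s2 + s3), 0, 0, 0, 0, 0, 0#} \<and>
    spectral_norm (J_SVD M) = 2 / (s2 + s3) \<and>
    condition_number (J_SVD M) = (s1 + s2) / (s2 + s3) \<and>
    (\<forall>(F :: 'p filter) (M' :: 'p \<Rightarrow> real^3^3) U' V' s1' s2' s3'.
       (\<forall>\<^sub>F t in F. det (M' t) > 0 \<and>
          is_svd (M' t) (U' t) (vector [s1' t, s2' t, s3' t]) (V' t) \<and>
          s1' t > s2' t \<and> s2' t > s3' t \<and> s3' t > 0) \<longrightarrow>
       (s3' \<longlongrightarrow> 0) F \<longrightarrow>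
       (\<lambda>t. spectral_norm (J_SVD (M' t))) \<in> O[F](\<lambda>t. 1 / s3' t))"
proof (intro conjI ballI allI impI)
  let ?g = "polar_gain (vector [s1, s2, s3])"
  have det: "det M \<noteq> 0"
    using assms(1) by simp
  obtain Q where Q: "is_svd (J_SVD M) Q ?g Q"
    using J_SVD_svd[OF assms(2) det] .
  show "vec_polar_rotation differentiable (at (vec_of_mat M))"
    using has_derivative_vec_polar_rotation[OF assms(2) det] by (rule differentiableI)
  \<comment> \<open>All pairwise sums of singular values are positive, so exactly three of the nine
    gains are nonzero; rank and nullity follow by counting.\<close>
  have nonzero: "{p. ?g $ p \<noteq> 0} = upper_pairs"
    using assms(3-5) by (auto simp: polar_gain_def upper_pairs_def)
  then have zero: "{p. ?g $ p = 0} = UNIV - upper_pairs"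
    by blast
  show "rank (J_SVD M) = 3"
    unfolding svd_rank[OF Q] nonzero by (simp add: upper_pairs_def)
  show "dim {x. J_SVD M *v x = 0} = 6"
    unfolding svd_dim_kernel[OF Q] zero by (simp add: card_Diff_subset upper_pairs_def)
  show "singular_values (J_SVD M) =
      {#2 / (s1 + s2), 2 / (s1 + s3), 2 / (s2 + s3), 0, 0, 0, 0, 0, 0#}"
    by (rule J_SVD_singular_values[OF assms(1,2)])
  then have sv: "set_mset (singular_values (J_SVD M)) =
      {2 / (s1 + s2), 2 / (s1 + s3), 2 / (s2 + s3), 0}"
    by auto
  have "Max {2 / (s1 + s2), 2 / (s1 + s3), 2 / (s2 + s3), 0} = 2 / (s2 + s3)"
    using assms(3-5) by (intro Max_eqI) (auto intro!: divide_left_mono)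
  \<comment> \<open>The smallest nonzero gain belongs to the largest sum,
    \<open>s1 + s2\<close>.\<close>
  moreover have "Min ({2 / (s1 + s2), 2 / (s1 + s3), 2 / (s2 + s3), 0} - {0}) = 2 / (s1 + s2)"
    using assms(3-5) by (intro Min_eqI) (auto intro!: divide_left_mono)
  moreover have "(2 / (s2 + s3)) / (2 / (s1 + s2)) = (s1 + s2) / (s2 + s3)"
    using assms(3-5) by (simp add: field_simps)
  ultimately show "condition_number (J_SVD M) = (s1 + s2) / (s2 + s3)"
    unfolding condition_number_def sv by (simp only:)
  show "spectral_norm (J_SVD M) = 2 / (s2 + s3)"
    by (rule J_SVD_spectral_norm[OF assms])
next
  fix Q :: "real^3^3" assume "Q \<in> SO3"
  then show "dim (tangent_space SO3 Q) = 3"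
    by (rule dim_tangent_space_SO3)
next
  fix F :: "'p filter" and M' :: "'p \<Rightarrow> real^3^3" and U' V' s1' s2' s3'
  assume "\<forall>\<^sub>F t in F. det (M' t) > 0 \<and>
      is_svd (M' t) (U' t) (vector [s1' t, s2' t, s3' t]) (V' t) \<and>
      s1' t > s2' t \<and> s2' t > s3' t \<and> s3' t > 0"
  \<comment> \<open>The constant 2 comes from discarding the positive term \<open>s2' t\<close> in
    the denominator of \<open>2 / (s2' t + s3' t)\<close>.\<close>
  then have "\<forall>\<^sub>F t in F. norm (spectral_norm (J_SVD (M' t))) \<le> 2 * norm (1 / s3' t)"
  proof eventually_elim
    case (elim t)
    then have "spectral_norm (J_SVD (M' t)) = 2 / (s2' t + s3' t)"
      using J_SVD_spectral_norm by blast
    moreover have "2 / (s2' t + s3' t) \<le> 2 / s3' t"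
      using elim by (intro divide_left_mono) auto
    ultimately show ?case
      using elim by simp
  qed
  then show "(\<lambda>t. spectral_norm (J_SVD (M' t))) \<in> O[F](\<lambda>t. 1 / s3' t)"
    by (rule bigoI)
qed

end
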